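(* Let $n\ge1$ and let $u\in C(Q_1)$ be a nonnegative weak solution to $$\partial_t u-\Delta u=-1\quad\text{in }\{u>0\}\cap Q_1.$$ Then there exists a constant $c_\circ>0$ depending only on $n$ such that, for every $(x_0,t_0)\in\overline{\{u>0\}}\cap Q_{1/2}$ and every $r\in(0,1/2)$, it holds $$\sup_{Q_r^-(x_0,t_0)}u\ge c_\circ r^2.$$
   Context: Parabolic cylinders: $Q_r(x_0,t_0):=\{(x,t)\in\mathbb{R}^n\times\mathbb{R}:|x-x_0|<r,\ |t-t_0|<r^2\}$ and $Q_r^-(x_0,t_0):=Q_r(x_0,t_0)\cap\{t<t_0\}$; the center is omitted when it is $(0,0)$, so $Q_r=Q_r(0,0)$. $\Delta$ is the Laplacian in $x$. Since $u$ is continuous, $\{u>0\}\cap Q_1$ is open, and the equation is understood in the weak sense in this open set. *)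

theory Defs
  imports "HOL-Analysis.Analysis"
begin

text \<open>Points of space-time \<open>\<real>\<^sup>n \<times> \<real>\<close> are pairs \<open>(x, t)\<close>.\<close>

definition par_cyl :: "real \<Rightarrow> 'a::real_normed_vector \<times> real \<Rightarrow> ('a \<times> real) set" where
  "par_cyl r = (\<lambda>(x0, t0). {(x, t). norm (x - x0) < r \<and> \<bar>t - t0\<bar> < r\<^sup>2})"

definition par_cyl_minus :: "real \<Rightarrow> 'a::real_normed_vector \<times> real \<Rightarrow> ('a \<times> real) set" where
  "par_cyl_minus r = (\<lambda>(x0, t0). par_cyl r (x0, t0) \<inter> {(x, t). t < t0})"

text \<open>\<open>Ck k f\<close>: \<open>f\<close> is \<open>k\<close> times continuously differentiable on the whole space. In finite
  dimension it is enough to ask this of every directional derivative \<open>\<lambda>x. f' x v\<close> instead of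
  the operator-valued map \<open>f'\<close>.\<close>

primrec Ck :: "nat \<Rightarrow> ('a::euclidean_space \<Rightarrow> real) \<Rightarrow> bool" where
  "Ck 0 f \<longleftrightarrow> continuous_on UNIV f"
| "Ck (Suc k) f \<longleftrightarrow> (\<exists>f'. (\<forall>x. (f has_derivative f' x) (at x)) \<and> (\<forall>v. Ck k (\<lambda>x. f' x v)))"

definition test_function :: "'a::euclidean_space set \<Rightarrow> ('a \<Rightarrow> real) \<Rightarrow> bool" where
  "test_function \<Omega> \<phi> \<longleftrightarrow>
     (\<forall>k. Ck k \<phi>) \<and> compact (closure {p. \<phi> p \<noteq> 0}) \<and> closure {p. \<phi> p \<noteq> 0} \<subseteq> \<Omega>"

definition time_deriv :: "('a \<times> real \<Rightarrow> real) \<Rightarrow> 'a \<times> real \<Rightarrow> real" where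
  "time_deriv \<phi> = (\<lambda>(x, t). deriv (\<lambda>s. \<phi> (x, s)) t)"

definition space_laplacian ::
    "('a::euclidean_space \<times> real \<Rightarrow> real) \<Rightarrow> 'a \<times> real \<Rightarrow> real" where
  "space_laplacian \<phi> = (\<lambda>(x, t). \<Sum>b\<in>Basis. (deriv ^^ 2) (\<lambda>s. \<phi> (x + s *\<^sub>R b, t)) 0)"

text \<open>\<open>\<partial>\<^sub>t u - \<Delta> u = f\<close> in the open set \<open>\<Omega>\<close>, tested against smooth compactly supported functions
  with all derivatives moved to the test function. The definition is meant for \<open>u\<close> and \<open>f\<close>
  continuous on \<open>\<Omega>\<close>, so that both integrals converge; no differentiability of \<open>u\<close> is assumed.\<close>

definition weak_heat_solution_on ::
    "('a::euclidean_space \<times> real) set \<Rightarrow> ('a \<times> real \<Rightarrow> real) \<Rightarrow> ('a \<times> real \<Rightarrow> real) \<Rightarrow> bool" where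
  "weak_heat_solution_on \<Omega> f u \<longleftrightarrow>
     (\<forall>\<phi>. test_function \<Omega> \<phi> \<longrightarrow>
        (LINT p:\<Omega>|lborel. u p * (- time_deriv \<phi> p - space_laplacian \<phi> p)) =
        (LINT p:\<Omega>|lborel. f p * \<phi> p))"

end

theory Submission
  imports Defs
begin

text \<open>At a point \<open>(x\<^sub>1, t\<^sub>1)\<close> with \<open>u > 0\<close> compare \<open>u\<close> with the barrier
  \<open>c (|x - x\<^sub>1|\<^sup>2 - (t - t\<^sub>1))\<close>, \<open>c = 1 / (4 n + 2)\<close>, for which
  \<open>(\<partial>\<^sub>t - \<Delta>)\<close> equals \<open>- 1/2\<close>. If \<open>u < c \<rho>\<^sup>2\<close> on the closed past cylinder of radius \<open>\<rho>\<close>, the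
  difference is negative on the parabolic boundary and positive at the top centre, so its maximum is
  attained at a point of \<open>{u > 0}\<close> off the parabolic boundary, where the difference is a strict
  subsolution; this contradicts the maximum principle. As \<open>u\<close> is only a weak solution,
  the maximum is first made strict by a small quadratic perturbation and then \<open>u\<close> is replaced by a
  mollification, which solves the same equation classically near that point. Points of the
  closure of \<open>{u > 0}\<close> follow by uniform continuity.\<close>

section \<open>Smooth cutoffs built from exp(-1/z)\<close>

text \<open>The factor \<open>inverse z ^ m\<close> makes the span of the family closed under
  differentiation, so smoothness can be proved by induction for all \<open>m\<close> at
  once.\<close>

definition flat :: "nat \<Rightarrow> real \<Rightarrow> real" where
  "flat m z = (if z > 0 then exp (- inverse z) * inverse z ^ m else 0)"

lemma flat_nonneg: "0 \<le> flat m z"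
  by (simp add: flat_def)

lemma flat_eq_0: "z \<le> 0 \<Longrightarrow> flat m z = 0"
  by (simp add: flat_def)

lemma flat_pos: "0 < z \<Longrightarrow> 0 < flat m z"
  by (simp add: flat_def)

lemma flat_tendsto_0: "(flat m \<longlongrightarrow> 0) (at 0)"
proof -
  have "((\<lambda>z::real. (inverse z) ^ m / exp (inverse z)) \<longlongrightarrow> 0) (at_right 0)"
    using filterlim_compose[OF tendsto_power_div_exp_0 filterlim_inverse_at_top_right] by simp
  then have "(flat m \<longlongrightarrow> 0) (at_right 0)"
    by (rule Lim_transform_eventually)
      (auto simp: flat_def eventually_at_filter exp_minus divide_inverse mult.commute)
  moreover have "(flat m \<longlongrightarrow> 0) (at_left 0)"
    by (rule Lim_transform_eventually[OF tendsto_const])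
      (auto simp: flat_def eventually_at_filter)
  ultimately show ?thesis
    by (simp add: filterlim_split_at)
qed

lemma DERIV_flat: "(flat m has_real_derivative flat (m + 2) z - real m * flat (m + 1) z) (at z)"
proof -
  consider "z > 0" | "z < 0" | "z = 0" by linarith
  then show ?thesis
  proof cases
    case 1
    have "((\<lambda>z. exp (- inverse z) * inverse z ^ m) has_real_derivative
            exp (- inverse z) * (inverse z * inverse z) * inverse z ^ m +
            exp (- inverse z) * (real m * inverse z ^ (m - 1) * - (inverse z * inverse z))) (at z)"
      using 1 by (auto intro!: derivative_eq_intros)
    also have "exp (- inverse z) * (inverse z * inverse z) * inverse z ^ m +
            exp (- inverse z) * (real m * inverse z ^ (m - 1) * - (inverse z * inverse z)) =
            flat (m + 2) z - real m * flat (m + 1) z"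
      \<comment> \<open>The case distinction handles the truncated \<open>m - 1\<close>: at
        \<open>m = 0\<close> the factor \<open>real m\<close> removes that term.\<close>
      using 1 by (cases m) (simp_all add: flat_def algebra_simps)
    finally have "((\<lambda>z. exp (- inverse z) * inverse z ^ m) has_real_derivative
            flat (m + 2) z - real m * flat (m + 1) z) (at z)" .
    then show ?thesis
      by (rule has_field_derivative_transform_within_open[where S = "{0<..}"])
        (use 1 in \<open>auto simp: flat_def\<close>)
  next
    case 2
    have "((\<lambda>z. 0) has_real_derivative flat (m + 2) z - real m * flat (m + 1) z) (at z)"
      using 2 by (simp add: flat_eq_0)
    then show ?thesis
      by (rule has_field_derivative_transform_within_open[where S = "{..<0}"])
        (use 2 in \<open>auto simp: flat_def\<close>)
  next
    case 3
    \<comment> \<open>For nonzero h the difference quotient \<open>flat m h / h\<close> equals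
      \<open>flat (Suc m) h\<close>, so the limit at 0 is already known.\<close>
    have "((\<lambda>h. (flat m (0 + h) - flat m 0) / h) \<longlongrightarrow> 0) (at 0)"
      by (rule Lim_transform_eventually[OF flat_tendsto_0[of "Suc m"]])
        (auto simp: flat_def eventually_at_filter divide_inverse algebra_simps)
    then show ?thesis
      using 3 by (simp add: DERIV_def flat_eq_0)
  qed
qed

lemma continuous_on_flat: "continuous_on A (flat m)"
  by (rule DERIV_continuous_on) (rule has_field_derivative_at_within[OF DERIV_flat])

section \<open>Closure properties of the class \<open>Ck\<close>\<close>

lemma Ck_Suc_imp: "Ck (Suc k) f \<Longrightarrow> Ck k f"
proof (induction k arbitrary: f)
  case 0
  then obtain f' where "\<And>x. (f has_derivative f' x) (at x)" by auto
  then show ?case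
    by (auto intro!: continuous_at_imp_continuous_on has_derivative_continuous)
next
  case (Suc k)
  then obtain f' where "\<And>x. (f has_derivative f' x) (at x)" "\<And>v. Ck (Suc k) (\<lambda>x. f' x v)"
    unfolding Ck.simps(2)[of "Suc k"] by auto
  with Suc.IH show ?case unfolding Ck.simps(2)[of k] by blast
qed

lemma Ck_const: "Ck k (\<lambda>x. c)"
proof (induction k arbitrary: c)
  case (Suc k)
  show ?case unfolding Ck.simps
    by (rule exI[of _ "\<lambda>x v. 0"]) (auto intro: Suc)
qed simp

lemma Ck_bounded_linear: "bounded_linear f \<Longrightarrow> Ck k f"
proof (cases k)
  case (Suc j)
  assume "bounded_linear f"
  then show ?thesis unfolding Suc Ck.simps
    by (intro exI[of _ "\<lambda>x. f"]) (auto intro: Ck_const bounded_linear_imp_has_derivative)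
qed (simp add: linear_continuous_on)

lemma Ck_add: "Ck k f \<Longrightarrow> Ck k g \<Longrightarrow> Ck k (\<lambda>x. f x + g x)"
proof (induction k arbitrary: f g)
  case 0
  then show ?case by (auto intro: continuous_intros)
next
  case (Suc k)
  obtain f' where f': "\<And>x. (f has_derivative f' x) (at x)" "\<And>v. Ck k (\<lambda>x. f' x v)"
    using Suc.prems by auto
  obtain g' where g': "\<And>x. (g has_derivative g' x) (at x)" "\<And>v. Ck k (\<lambda>x. g' x v)"
    using Suc.prems by auto
  show ?case unfolding Ck.simps
    by (rule exI[of _ "\<lambda>x v. f' x v + g' x v"]) (auto intro!: has_derivative_add f' g' Suc.IH)
qed

lemma Ck_mult: "Ck k f \<Longrightarrow> Ck k g \<Longrightarrow> Ck k (\<lambda>x. f x * g x)"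
proof (induction k arbitrary: f g)
  case 0
  then show ?case by (auto intro: continuous_intros)
next
  case (Suc k)
  obtain f' where f': "\<And>x. (f has_derivative f' x) (at x)" "\<And>v. Ck k (\<lambda>x. f' x v)"
    using Suc.prems by auto
  obtain g' where g': "\<And>x. (g has_derivative g' x) (at x)" "\<And>v. Ck k (\<lambda>x. g' x v)"
    using Suc.prems by auto
  \<comment> \<open>The product rule leaves one factor undifferentiated in each summand; lowering
    its order by one makes the induction hypothesis applicable.\<close>
  have "Ck k f" "Ck k g" using Suc.prems Ck_Suc_imp by blast+
  then show ?case unfolding Ck.simps
    by (intro exI[of _ "\<lambda>x v. f x * g' x v + f' x v * g x"])
      (auto intro!: has_derivative_mult f' g' Suc.IH Ck_add)
qed

text \<open>Each directional derivative is a combination of \<open>flat (m + 2)\<close> and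
  \<open>flat (m + 1)\<close> at the same argument, times an affine function of \<open>q\<close>.
  Induction with \<open>m\<close> arbitrary and closure under sums and products then suffice,
  without a chain rule for \<open>Ck\<close>.\<close>

lemma Ck_flat:
  fixes p :: "'a::euclidean_space"
  shows "Ck k (\<lambda>q. flat m (c - (norm (q - p))\<^sup>2))"
proof (induction k arbitrary: m)
  case 0
  show ?case
    by (auto intro!: continuous_intros continuous_on_compose2[OF continuous_on_flat[of UNIV]])
next
  case (Suc k)
  let ?z = "\<lambda>q. c - (norm (q - p))\<^sup>2"
  let ?D = "\<lambda>q v. (flat (m + 2) (?z q) - real m * flat (m + 1) (?z q)) * (- 2 * ((q - p) \<bullet> v))"
  have "((\<lambda>q. flat m (?z q)) has_derivative ?D q) (at q)" for q
  proof -
    have "(?z has_derivative (\<lambda>v. - 2 * ((q - p) \<bullet> v))) (at q)"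
      unfolding power2_norm_eq_inner
      by (auto intro!: derivative_eq_intros simp: inner_commute)
    from has_derivative_compose[OF this DERIV_flat[unfolded has_field_derivative_def]]
    show ?thesis by (simp add: o_def)
  qed
  moreover have "Ck k (\<lambda>q. ?D q v)" for v
  proof -
    have "?D q v = (flat (m + 2) (?z q) + (- real m) * flat (m + 1) (?z q)) *
        ((- 2) * (q \<bullet> v) + 2 * (p \<bullet> v))" for q
      by (simp add: algebra_simps inner_diff_left)
    moreover have "Ck k (\<lambda>q. q \<bullet> v)"
      by (rule Ck_bounded_linear) (rule bounded_linear_inner_left)
    ultimately show ?thesis
      by (simp only:) (intro Ck_mult Ck_add Ck_const Suc)
  qed
  ultimately show ?case unfolding Ck.simps by (intro exI[of _ ?D]) auto
qed

section \<open>The mollifier and its directional derivatives\<close>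

text \<open>\<open>ker e\<close> is an unnormalised mollifier supported in the ball of radius \<open>e\<close>; \<open>ker1 e v\<close> and
  \<open>ker2 e v\<close> are its first and second derivatives in direction \<open>v\<close>.\<close>

definition ker :: "real \<Rightarrow> 'a::euclidean_space \<Rightarrow> real" where
  "ker e w = flat 0 (e\<^sup>2 - (norm w)\<^sup>2)"

definition ker1 :: "real \<Rightarrow> 'a::euclidean_space \<Rightarrow> 'a \<Rightarrow> real" where
  "ker1 e v w = - 2 * flat 2 (e\<^sup>2 - (norm w)\<^sup>2) * (w \<bullet> v)"

definition ker2 :: "real \<Rightarrow> 'a::euclidean_space \<Rightarrow> 'a \<Rightarrow> real" where
  "ker2 e v w = 4 * (flat 4 (e\<^sup>2 - (norm w)\<^sup>2) - 2 * flat 3 (e\<^sup>2 - (norm w)\<^sup>2)) * (w \<bullet> v)\<^sup>2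
     - 2 * flat 2 (e\<^sup>2 - (norm w)\<^sup>2) * (v \<bullet> v)"

lemma ker_nonneg: "0 \<le> ker e w"
  by (simp add: ker_def flat_nonneg)

lemma ker_pos: "norm w < e \<Longrightarrow> 0 < ker e w"
  unfolding ker_def by (rule flat_pos) (simp add: power_strict_mono)

lemma ker_outside:
  assumes "0 < e" "e \<le> norm w"
  shows "ker e w = 0" "ker1 e v w = 0" "ker2 e v w = 0"
  using assms by (auto simp: ker_def ker1_def ker2_def flat_eq_0 power_mono)

lemma ker_minus: "ker e (- w) = ker e w" "ker1 e v (- w) = - ker1 e v w" "ker2 e v (- w) = ker2 e v w"
  by (simp_all add: ker_def ker1_def ker2_def)

text \<open>Evenness of the mollifier: it converts a test function of \<open>q\<close> centred at
  \<open>p\<close> into a convolution kernel evaluated at \<open>p\<close>, with a sign change only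
  at first order.\<close>

lemma ker_commute: "ker e (q - p) = ker e (p - q)"
  "ker1 e v (q - p) = - ker1 e v (p - q)" "ker2 e v (q - p) = ker2 e v (p - q)"
  using ker_minus[where w = "p - q"] by simp_all

lemma continuous_on_ker [continuous_intros]:
  assumes "continuous_on A f"
  shows "continuous_on A (\<lambda>x. ker e (f x))" "continuous_on A (\<lambda>x. ker1 e v (f x))"
    "continuous_on A (\<lambda>x. ker2 e v (f x))"
  unfolding ker_def ker1_def ker2_def
  by (intro continuous_intros assms continuous_on_compose2[OF continuous_on_flat[of UNIV]]; simp)+

lemma DERIV_ker_line:
  shows "((\<lambda>s. ker e (w + s *\<^sub>R v)) has_real_derivative ker1 e v (w + s *\<^sub>R v)) (at s within S)"
    and "((\<lambda>s. ker1 e v (w + s *\<^sub>R v)) has_real_derivative ker2 e v (w + s *\<^sub>R v)) (at s within S)"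
proof -
  let ?z = "\<lambda>s. e\<^sup>2 - (norm (w + s *\<^sub>R v))\<^sup>2"
  let ?i = "\<lambda>s. (w + s *\<^sub>R v) \<bullet> v"
  have z: "(?z has_real_derivative - 2 * ?i s) (at s within S)"
    unfolding power2_norm_eq_inner has_field_derivative_def
    by (auto intro!: derivative_eq_intros simp: inner_commute algebra_simps)
  have i: "(?i has_real_derivative v \<bullet> v) (at s within S)"
    unfolding has_field_derivative_def
    by (auto intro!: derivative_eq_intros simp: algebra_simps)
  note flat = DERIV_chain2[OF DERIV_flat z]
  show "((\<lambda>s. ker e (w + s *\<^sub>R v)) has_real_derivative ker1 e v (w + s *\<^sub>R v)) (at s within S)"
    using flat[of 0] by (simp add: ker_def ker1_def numeral_2_eq_2 mult.assoc mult.left_commute)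
  show "((\<lambda>s. ker1 e v (w + s *\<^sub>R v)) has_real_derivative ker2 e v (w + s *\<^sub>R v)) (at s within S)"
    unfolding ker1_def
    by (rule DERIV_cong[OF DERIV_mult[OF DERIV_cmult[OF flat] i]])
      (simp add: ker2_def algebra_simps power2_eq_square eval_nat_numeral)
qed


section \<open>Mass of the mollifier\<close>

lemma integral_eq_of_zero_outside:
  fixes f :: "'a::euclidean_space \<Rightarrow> real"
  assumes "\<And>x. x \<in> S - T \<Longrightarrow> f x = 0" "\<And>x. x \<in> T - S \<Longrightarrow> f x = 0"
  shows "integral S f = integral T f"
proof -
  have "(\<lambda>x. if x \<in> S then f x else 0) = (\<lambda>x. if x \<in> T then f x else 0)"
    using assms by fastforce
  then show ?thesis by (metis integral_restrict_UNIV)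
qed

text \<open>The whole support of the shifted kernel lies in the box, so nothing is cut off and the
  mass does not depend on \<open>p\<close>.\<close>

lemma integral_ker_translate:
  fixes p :: "'a::euclidean_space"
  assumes "0 < e" "cball p e \<subseteq> cbox a b"
  shows "integral (cbox a b) (\<lambda>q. ker e (p - q)) = integral (cball (0::'a) e) (ker e)"
proof -
  have "integral (cbox a b) (\<lambda>q. ker e (p - q)) = integral (cbox a b) (\<lambda>q. ker e (q + - p))"
    by (intro integral_cong) (metis ker_minus(1) minus_diff_eq add_uminus_conv_diff)
  also have "\<dots> = integral (cbox (a - p) (b - p)) (ker e)"
    using integral_shift_cbox[of "a - p" "- p" "b - p" "ker e"] by simp
  also have "\<dots> = integral (cball (0::'a) e) (ker e)"
  proof (rule integral_eq_of_zero_outside)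
    show "ker e x = 0" if "x \<in> cbox (a - p) (b - p) - cball 0 e" for x
      using that assms by (auto intro!: ker_outside)
    show "ker e x = 0" if "x \<in> cball 0 e - cbox (a - p) (b - p)" for x
    proof -
      have "x + p \<in> cball p e" using that by (simp add: dist_norm)
      then have "x + p \<in> cbox a b" using assms by blast
      then have "x \<in> cbox (a - p) (b - p)" by (simp add: mem_box algebra_simps)
      with that show ?thesis by blast
    qed
  qed
  finally show ?thesis .
qed

text \<open>A continuous nonnegative function with zero integral over a box vanishes on it, but the
  kernel is positive at its centre.\<close>

lemma integral_ker_pos:
  assumes "0 < e"
  shows "0 < integral (cball 0 e) (ker e :: 'a::euclidean_space \<Rightarrow> real)"
proof -
  obtain a b :: 'a where ab: "cball 0 e \<subseteq> cbox a b"
    using bounded_subset_cbox_symmetric[OF bounded_cball] by metis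
  have "0 \<in> box a b"
    using ab assms by (metis ball_subset_cball centre_in_ball interior_cbox interior_maximal open_ball subset_iff subset_trans)
  have eq: "integral (cbox a b) (ker e) = integral (cball 0 e) (ker e :: 'a \<Rightarrow> real)"
    by (rule integral_eq_of_zero_outside) (use ab assms in \<open>auto intro!: ker_outside\<close>)
  have "integral (cbox a b) (ker e) \<noteq> 0"
  proof
    assume "integral (cbox a b) (ker e) = (0::real)"
    moreover have cont: "continuous_on (cbox a b) (ker e)"
      using continuous_on_ker(1)[OF continuous_on_id] by simp
    ultimately have "(ker e has_integral 0) (cbox a b)"
      using integrable_continuous has_integral_integral by metis
    from has_integral_0_cbox_imp_0[OF cont ker_nonneg this, of 0] \<open>0 \<in> box a b\<close>
    have "ker e (0::'a) = 0" by (metis box_subset_cbox subset_iff empty_iff)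
    then show False using ker_pos[of "0::'a" e] assms by simp
  qed
  moreover have "0 \<le> integral (cbox a b) (ker e)"
    by (rule integral_nonneg)
      (auto intro!: integrable_continuous ker_nonneg continuous_on_ker continuous_on_id)
  ultimately show ?thesis using eq by simp
qed

section \<open>Mollification of weak solutions\<close>

text \<open>Differentiation under the integral puts every derivative on the kernel, so continuity of
  \<open>u\<close> on the box is enough.\<close>

lemma DERIV_mollify_line:
  fixes u :: "'a::euclidean_space \<Rightarrow> real"
  assumes u: "continuous_on (cbox a b) u"
  shows "((\<lambda>s. integral (cbox a b) (\<lambda>q. u q * ker e (p + s *\<^sub>R v - q))) has_real_derivative
      integral (cbox a b) (\<lambda>q. u q * ker1 e v (p + s *\<^sub>R v - q))) (at s)"
    and "((\<lambda>s. integral (cbox a b) (\<lambda>q. u q * ker1 e v (p + s *\<^sub>R v - q))) has_real_derivative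
      integral (cbox a b) (\<lambda>q. u q * ker2 e v (p + s *\<^sub>R v - q))) (at s)"
proof -
  have eq: "p + s *\<^sub>R v - q = (p - q) + s *\<^sub>R v" for s q by simp
  have cu: "continuous_on (UNIV \<times> cbox a b) (\<lambda>x::real \<times> 'a. u (snd x))"
    by (rule continuous_on_compose2[OF u]) (auto intro!: continuous_intros)
  show "((\<lambda>s. integral (cbox a b) (\<lambda>q. u q * ker e (p + s *\<^sub>R v - q))) has_real_derivative
      integral (cbox a b) (\<lambda>q. u q * ker1 e v (p + s *\<^sub>R v - q))) (at s)"
    by (rule leibniz_rule_field_derivative)
      (auto simp: split_beta intro!: integrable_continuous continuous_intros u cu
        DERIV_cmult DERIV_ker_line(1)[of e "p - q" v for q, folded eq])
  show "((\<lambda>s. integral (cbox a b) (\<lambda>q. u q * ker1 e v (p + s *\<^sub>R v - q))) has_real_derivative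
      integral (cbox a b) (\<lambda>q. u q * ker2 e v (p + s *\<^sub>R v - q))) (at s)"
    by (rule leibniz_rule_field_derivative)
      (auto simp: split_beta intro!: integrable_continuous continuous_intros u cu
        DERIV_cmult DERIV_ker_line(2)[of e v "p - q" for q, folded eq])
qed

lemma test_function_ker:
  fixes p :: "'a::euclidean_space"
  assumes "0 < e" "cball p e \<subseteq> \<Omega>"
  shows "test_function \<Omega> (\<lambda>q. ker e (q - p))"
proof -
  have sub: "closure {q. ker e (q - p) \<noteq> 0} \<subseteq> cball p e"
  proof (rule closure_minimal)
    show "{q. ker e (q - p) \<noteq> 0} \<subseteq> cball p e"
      using assms(1) ker_outside(1) by (force simp: dist_norm norm_minus_commute)
  qed simp
  have "compact (closure {q. ker e (q - p) \<noteq> 0})"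
    using sub by (metis closed_closure bounded_cball bounded_subset compact_eq_bounded_closed)
  then show ?thesis
    using sub assms Ck_flat unfolding test_function_def ker_def by blast
qed

lemma time_deriv_ker:
  "time_deriv (\<lambda>q. ker e (q - p)) q = ker1 e (0, 1) (q - p)"
proof -
  obtain x t where q: "q = (x, t)" by (cases q)
  have "ker e ((x, s) - p) = ker e (((x, 0) - p) + s *\<^sub>R (0, 1))" for s
    by (simp add: minus_prod_def plus_prod_def)
  moreover have "((x, 0) - p) + t *\<^sub>R (0, 1) = q - p"
    by (simp add: q minus_prod_def plus_prod_def)
  ultimately show ?thesis
    using DERIV_imp_deriv[OF DERIV_ker_line(1)[of e "(x, 0) - p" "(0, 1)" t UNIV]]
    by (simp only: time_deriv_def q case_prod_conv)
qed

lemma space_laplacian_ker: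
  "space_laplacian (\<lambda>q. ker e (q - p)) q = (\<Sum>b\<in>Basis. ker2 e (b, 0) (q - p))"
proof -
  obtain x t where q: "q = (x, t)" by (cases q)
  have "(deriv ^^ 2) (\<lambda>s. ker e ((x + s *\<^sub>R b, t) - p)) 0 = ker2 e (b, 0) (q - p)" for b
  proof -
    have "ker e ((x + s *\<^sub>R b, t) - p) = ker e ((q - p) + s *\<^sub>R (b, 0))" for s
      by (simp add: q minus_prod_def plus_prod_def algebra_simps)
    moreover have "deriv (\<lambda>s. ker e ((q - p) + s *\<^sub>R (b, 0))) =
        (\<lambda>s. ker1 e (b, 0) ((q - p) + s *\<^sub>R (b, 0)))"
      by (rule ext) (rule DERIV_imp_deriv[OF DERIV_ker_line(1)])
    moreover have "deriv (\<lambda>s. ker1 e (b, 0) ((q - p) + s *\<^sub>R (b, 0))) 0 = ker2 e (b, 0) (q - p)"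
      using DERIV_imp_deriv[OF DERIV_ker_line(2)[of e "(b, 0)" "q - p" 0 UNIV]]
      by (simp only: scaleR_zero_left add_0_right)
    ultimately show ?thesis by (simp add: eval_nat_numeral)
  qed
  then show ?thesis by (simp add: space_laplacian_def q)
qed

text \<open>Bridge from the Lebesgue integrals of the weak formulation to the integrals over a fixed
  box, in which the mollification is differentiated.\<close>

lemma set_lebesgue_integral_eq_integral_cbox:
  fixes f :: "'a::euclidean_space \<Rightarrow> real"
  assumes "cbox a b \<subseteq> \<Omega>" "continuous_on (cbox a b) f" "\<And>x. x \<in> \<Omega> - cbox a b \<Longrightarrow> f x = 0"
  shows "(LINT x:\<Omega>|lborel. f x) = integral (cbox a b) f"
proof -
  have "(LINT x:\<Omega>|lborel. f x) = (LINT x:cbox a b|lborel. f x)"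
    unfolding set_lebesgue_integral_def
    by (rule Bochner_Integration.integral_cong) (use assms in \<open>auto simp: indicator_def\<close>)
  also have "\<dots> = integral (cbox a b) f"
    by (rule set_borel_integral_eq_integral)
      (unfold set_integrable_def, rule borel_integrable_compact[OF compact_cbox assms(2)])
  finally show ?thesis .
qed

text \<open>The weak equation is tested with \<open>ker e (q - p)\<close> as a function of
  \<open>q\<close>. Since the first derivative of the kernel is odd, the minus sign before
  \<open>time_deriv\<close> disappears, and the result is the classical equation at \<open>p\<close>
  for the unnormalised mollification.\<close>

lemma mollified_heat_equation:
  fixes u :: "'a::euclidean_space \<times> real \<Rightarrow> real"
  assumes sol: "weak_heat_solution_on \<Omega> (\<lambda>p. - 1) u"
    and u: "continuous_on (cbox a b) u"
    and e: "0 < e" "cball p e \<subseteq> cbox a b" "cbox a b \<subseteq> \<Omega>"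
  shows "integral (cbox a b) (\<lambda>q. u q * ker1 e (0, 1) (p - q)) -
      (\<Sum>i\<in>Basis. integral (cbox a b) (\<lambda>q. u q * ker2 e (i, 0) (p - q))) =
      - integral (cball 0 e) (ker e :: 'a \<times> real \<Rightarrow> real)"
proof -
  let ?f = "\<lambda>q. u q * ker1 e (0, 1) (p - q) - (\<Sum>i\<in>Basis. u q * ker2 e (i, 0) (p - q))"
  have cont: "continuous_on (cbox a b) (\<lambda>q. u q * ker1 e v (p - q))"
    "continuous_on (cbox a b) (\<lambda>q. u q * ker2 e v (p - q))" for v
    by (intro continuous_intros u)+
  have out: "e \<le> norm (p - q)" if "q \<in> \<Omega> - cbox a b" for q
    using that e(2) by (force simp: dist_norm)
  have "cball p e \<subseteq> \<Omega>" using e by blast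
  then have "(LINT q:\<Omega>|lborel. u q * (- time_deriv (\<lambda>q. ker e (q - p)) q
        - space_laplacian (\<lambda>q. ker e (q - p)) q)) = (LINT q:\<Omega>|lborel. - 1 * ker e (q - p))"
    using sol test_function_ker[OF e(1)] unfolding weak_heat_solution_on_def by blast
  moreover have "u q * (- time_deriv (\<lambda>q. ker e (q - p)) q
        - space_laplacian (\<lambda>q. ker e (q - p)) q) = ?f q" for q
    by (simp add: time_deriv_ker space_laplacian_ker ker_commute(1)[of e q p] ker_commute(2,3)[of e _ q p]
        right_diff_distrib sum_distrib_left)
  ultimately have "(LINT q:\<Omega>|lborel. ?f q) = (LINT q:\<Omega>|lborel. - ker e (p - q))"
    by (simp add: ker_commute(1)[of e _ p])
  moreover have "(LINT q:\<Omega>|lborel. ?f q) = integral (cbox a b) ?f"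
    by (rule set_lebesgue_integral_eq_integral_cbox)
      (use e out in \<open>auto simp: ker_outside intro!: continuous_intros cont\<close>)
  moreover have "(LINT q:\<Omega>|lborel. - ker e (p - q)) = integral (cbox a b) (\<lambda>q. - ker e (p - q))"
    by (rule set_lebesgue_integral_eq_integral_cbox)
      (use e out in \<open>auto simp: ker_outside intro!: continuous_intros\<close>)
  moreover have "integral (cbox a b) (\<lambda>q. \<Sum>i\<in>Basis. u q * ker2 e (i, 0) (p - q)) =
      (\<Sum>i\<in>Basis. integral (cbox a b) (\<lambda>q. u q * ker2 e (i, 0) (p - q)))"
    by (rule integral_sum) (auto intro!: integrable_continuous cont)
  moreover have "integral (cbox a b) ?f =
     integral (cbox a b) (\<lambda>q. u q * ker1 e (0, 1) (p - q)) -
      integral (cbox a b) (\<lambda>q. \<Sum>i\<in>Basis. u q * ker2 e (i, 0) (p - q))"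
    by (rule integral_diff) (auto intro!: integrable_continuous continuous_intros cont)
  ultimately show ?thesis
    using integral_ker_translate[OF e(1,2)] by simp
qed

text \<open>The quotient is an average of \<open>u\<close> with nonnegative weights of total mass
  one that vanish outside \<open>cball p e\<close>.\<close>

lemma mollify_close:
  fixes u :: "'a::euclidean_space \<Rightarrow> real"
  assumes u: "continuous_on (cbox a b) u"
    and e: "0 < e" "cball p e \<subseteq> cbox a b"
    and close: "\<And>q. q \<in> cball p e \<Longrightarrow> \<bar>u q - u p\<bar> \<le> \<eta>"
  shows "\<bar>integral (cbox a b) (\<lambda>q. u q * ker e (p - q)) / integral (cball (0::'a) e) (ker e) - u p\<bar> \<le> \<eta>"
proof -
  define N where "N = integral (cball (0::'a) e) (ker e)"
  have N: "0 < N" unfolding N_def by (rule integral_ker_pos[OF e(1)])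
  have int: "(\<lambda>q. c * ker e (p - q)) integrable_on cbox a b"
    "(\<lambda>q. u q * ker e (p - q)) integrable_on cbox a b" for c
    by (auto intro!: integrable_continuous continuous_intros u)
  have Nc: "integral (cbox a b) (\<lambda>q. c * ker e (p - q)) = c * N" for c
    using integral_ker_translate[OF e] by (simp add: N_def)
  have bd: "(u p - \<eta>) * ker e (p - q) \<le> u q * ker e (p - q)"
    "u q * ker e (p - q) \<le> (u p + \<eta>) * ker e (p - q)" for q
  proof -
    have "ker e (p - q) = 0 \<or> \<bar>u q - u p\<bar> \<le> \<eta>"
      using close ker_outside(1)[OF e(1), of "p - q"] by (force simp: dist_norm)
    then have "(u p - \<eta>) * ker e (p - q) \<le> u q * ker e (p - q) \<and>
      u q * ker e (p - q) \<le> (u p + \<eta>) * ker e (p - q)"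
    proof
      assume "\<bar>u q - u p\<bar> \<le> \<eta>"
      then show ?thesis by (intro conjI mult_right_mono ker_nonneg) auto
    qed simp
    then show "(u p - \<eta>) * ker e (p - q) \<le> u q * ker e (p - q)"
      "u q * ker e (p - q) \<le> (u p + \<eta>) * ker e (p - q)" by auto
  qed
  have "(u p - \<eta>) * N \<le> integral (cbox a b) (\<lambda>q. u q * ker e (p - q))"
    unfolding Nc[symmetric] by (rule integral_le[OF int(1) int(2)]) (rule bd)
  moreover have "integral (cbox a b) (\<lambda>q. u q * ker e (p - q)) \<le> (u p + \<eta>) * N"
    unfolding Nc[symmetric] by (rule integral_le[OF int(2) int(1)]) (rule bd)
  ultimately show ?thesis
    using N unfolding N_def[symmetric] abs_le_iff by (auto simp: field_simps)
qed

section \<open>Maximum principle for weak solutions\<close>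

text \<open>One-sided version for the time variable: the maximum may sit at the latest admissible
  time, where only earlier times can be compared.\<close>

lemma left_local_max_deriv_nonneg:
  fixes g :: "real \<Rightarrow> real"
  assumes "(g has_real_derivative l) (at 0)" "0 < d" "\<And>s. - d < s \<Longrightarrow> s \<le> 0 \<Longrightarrow> g s \<le> g 0"
  shows "0 \<le> l"
proof (rule ccontr)
  assume "\<not> 0 \<le> l"
  then obtain d' where d': "0 < d'" "\<And>h. 0 < h \<Longrightarrow> h < d' \<Longrightarrow> g 0 < g (0 - h)"
    using DERIV_neg_dec_left[OF assms(1)] by auto
  define h where "h = min d d' / 2"
  have "0 < h" "h < d" "h < d'" using assms(2) d'(1) by (auto simp: h_def)
  with d'(2)[of h] assms(3)[of "- h"] show False by simp
qed

text \<open>With \<open>l\<close> positive, \<open>g'\<close> would vanish at 0 and be positive just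
  to the right, so by the mean value theorem \<open>g\<close> would rise above
  \<open>g 0\<close>.\<close>

lemma local_max_second_deriv_nonpos:
  fixes g :: "real \<Rightarrow> real"
  assumes g: "\<And>s. (g has_real_derivative g' s) (at s)"
    and g': "(g' has_real_derivative l) (at 0)"
    and d: "0 < d" "\<And>s. \<bar>s\<bar> < d \<Longrightarrow> g s \<le> g 0"
  shows "l \<le> 0"
proof (rule ccontr)
  assume "\<not> l \<le> 0"
  then obtain d' where d': "0 < d'" "\<And>h. 0 < h \<Longrightarrow> h < d' \<Longrightarrow> g' 0 < g' (0 + h)"
    using DERIV_pos_inc_right[OF g'] by auto
  have "g' 0 = 0"
    by (rule DERIV_local_max[OF g d(1)]) (use d(2) in auto)
  define h where "h = min d d' / 2"
  have h: "0 < h" "h < d" "h < d'" using d d' by (auto simp: h_def min_def)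
  then obtain z where "0 < z" "z < h" "g h - g 0 = (h - 0) * g' z"
    using MVT2[of 0 h g g'] g by blast
  moreover have "g h \<le> g 0" using h d by simp
  moreover have "0 < h * g' z" using calculation(1,2) d'(2)[of z] h \<open>g' 0 = 0\<close> by simp
  ultimately show False by simp
qed

text \<open>Here \<open>\<psi>\<close> is a strict supersolution. The quadratic gap survives
  replacing \<open>u\<close> by a mollification \<open>V\<close> close to it, so
  \<open>V - \<psi>\<close> has a maximum over the past half-ball off the sphere, where the
  derivative tests contradict the classical equation for \<open>V\<close>.\<close>

lemma weak_heat_solution_no_touching_above:
  fixes u \<psi> :: "'a::euclidean_space \<times> real \<Rightarrow> real"
  assumes \<Omega>: "continuous_on \<Omega> u" "weak_heat_solution_on \<Omega> (\<lambda>p. - 1) u"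
    and R: "0 < R" "ball p R \<subseteq> \<Omega>" and \<kappa>: "0 < \<kappa>"
    and \<psi>: "continuous_on UNIV \<psi>"
    and \<psi>t: "\<And>q. ((\<lambda>s. \<psi> (q + s *\<^sub>R (0, 1))) has_real_derivative \<psi>t q) (at 0)"
    and \<psi>x: "\<And>q i s. i \<in> Basis \<Longrightarrow>
      ((\<lambda>s. \<psi> (q + s *\<^sub>R (i, 0))) has_real_derivative \<psi>x i (q + s *\<^sub>R (i, 0))) (at s)"
    and \<psi>xx: "\<And>q i. i \<in> Basis \<Longrightarrow>
      ((\<lambda>s. \<psi>x i (q + s *\<^sub>R (i, 0))) has_real_derivative \<psi>xx i q) (at 0)"
    and strict: "\<And>q. q \<in> ball p R \<Longrightarrow> - 1 < \<psi>t q - (\<Sum>i\<in>Basis. \<psi>xx i q)"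
    and max: "\<And>q. q \<in> ball p R \<Longrightarrow> snd q \<le> snd p \<Longrightarrow>
      u q - \<psi> q \<le> u p - \<psi> p - \<kappa> * (dist p q)\<^sup>2"
  shows False
proof -
  obtain a b where ab: "cbox a b \<subseteq> ball p R" "p \<in> box a b"
    using open_contains_cbox[OF open_ball, of p p R] R by (metis centre_in_ball)
  obtain d0 where d0: "0 < d0" "ball p d0 \<subseteq> box a b"
    using ab(2) open_box[of a b] unfolding open_contains_ball by blast
  \<comment> \<open>The ball of radius \<open>2 * d\<close> must fit in the box: \<open>d\<close>
    for the centre of the kernel and at most \<open>d\<close> for its radius.\<close>
  define d where "d = d0 / 3"
  have "cball p (2 * d) \<subseteq> ball p d0"
    using d0 by (auto simp: d_def)
  then have d: "0 < d" "cball p (2 * d) \<subseteq> cbox a b"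
    using d0 box_subset_cbox[of a b] by (auto simp: d_def)
  have u: "continuous_on (cbox a b) u"
    using ab R \<Omega>(1) continuous_on_subset by blast
  \<comment> \<open>The gap on the sphere of radius \<open>d\<close> is \<open>4 * \<eta>\<close>,
    while mollification costs at most \<open>\<eta>\<close> at each of the two points
    compared.\<close>
  define \<eta> where "\<eta> = \<kappa> * d\<^sup>2 / 4"
  have \<eta>: "0 < \<eta>" using \<kappa> d by (simp add: \<eta>_def)
  obtain e0 where e0: "0 < e0"
    "\<And>q q'. q \<in> cbox a b \<Longrightarrow> q' \<in> cbox a b \<Longrightarrow> dist q' q < e0 \<Longrightarrow> dist (u q') (u q) < \<eta>"
    using compact_uniformly_continuous[OF u compact_cbox] \<eta> unfolding uniformly_continuous_on_def
    by metis
  define e where "e = min d (e0 / 2)"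
  have e: "0 < e" "e \<le> d" "e < e0" using d e0 by (auto simp: e_def)
  define N where "N = integral (cball (0::'a \<times> real) e) (ker e)"
  have N: "0 < N" unfolding N_def by (rule integral_ker_pos[OF e(1)])
  define V where "V q = integral (cbox a b) (\<lambda>q'. u q' * ker e (q - q')) / N" for q
  define V1 where "V1 v q = integral (cbox a b) (\<lambda>q'. u q' * ker1 e v (q - q')) / N" for v q
  define V2 where "V2 v q = integral (cbox a b) (\<lambda>q'. u q' * ker2 e v (q - q')) / N" for v q
  have dV: "((\<lambda>s. V (q + s *\<^sub>R v)) has_real_derivative V1 v (q + s *\<^sub>R v)) (at s)"
    "((\<lambda>s. V1 v (q + s *\<^sub>R v)) has_real_derivative V2 v (q + s *\<^sub>R v)) (at s)" for q v s
    unfolding V_def V1_def V2_def by (intro DERIV_cdivide DERIV_mollify_line[OF u])+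
  have ball_sub: "cball q e \<subseteq> cbox a b" if "q \<in> cball p d" for q
  proof -
    have "cball q e \<subseteq> cball p (2 * d)" using that e by (simp add: cball_subset_cball_iff dist_commute)
    with d show ?thesis by blast
  qed
  have close: "\<bar>V q - u q\<bar> \<le> \<eta>" if "q \<in> cball p d" for q
    unfolding V_def N_def
  proof (rule mollify_close[OF u e(1) ball_sub[OF that]])
    fix q' assume q': "q' \<in> cball q e"
    have "q \<in> cbox a b" "q' \<in> cbox a b" using e q' ball_sub[OF that] by auto
    moreover have "dist q' q < e0" using q' e by (simp add: dist_commute)
    ultimately show "\<bar>u q' - u q\<bar> \<le> \<eta>"
      using e0(2)[of q q'] by (simp add: dist_real_def)
  qed
  have heat: "V1 (0, 1) q - (\<Sum>i\<in>Basis. V2 (i, 0) q) = - 1" if "q \<in> cball p d" for q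
  proof -
    have "cbox a b \<subseteq> \<Omega>" using ab R by blast
    from mollified_heat_equation[OF \<Omega>(2) u e(1) ball_sub[OF that] this] N
    show ?thesis
      by (simp add: V1_def V2_def N_def[symmetric] sum_divide_distrib[symmetric] diff_divide_distrib[symmetric])
  qed
  define D where "D = cball p d \<inter> {q. snd q \<le> snd p}"
  have "compact D" unfolding D_def
    by (intro compact_Int_closed compact_cball closed_Collect_le continuous_intros)
  moreover have "continuous_on D (\<lambda>q. V q - \<psi> q)"
  proof -
    have "continuous_on (D \<times> cbox a b) (\<lambda>x. u (snd x))"
      by (rule continuous_on_compose2[OF u]) (auto intro!: continuous_intros)
    then have "continuous_on (D \<times> cbox a b) (\<lambda>(q, q'). u q' * ker e (q - q'))"
      by (auto simp: split_beta intro!: continuous_intros)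
    then have "continuous_on D (\<lambda>q. integral (cbox a b) (\<lambda>q'. u q' * ker e (q - q')))"
      by (rule integral_continuous_on_param)
    then show ?thesis
      unfolding V_def using N
      by (intro continuous_intros continuous_on_subset[OF \<psi>]) auto
  qed
  moreover have pD: "p \<in> D" using d by (simp add: D_def)
  ultimately obtain q where q: "q \<in> D" "\<And>q'. q' \<in> D \<Longrightarrow> V q' - \<psi> q' \<le> V q - \<psi> q"
    using continuous_attains_sup[of D "\<lambda>q. V q - \<psi> q"] by blast
  have qp: "q \<in> cball p d" "snd q \<le> snd p" using q(1) by (auto simp: D_def)
  have "q \<in> cball q e" using e(1) by simp
  then have qR: "q \<in> ball p R" using ball_sub[OF qp(1)] ab(1) by blast
  \<comment> \<open>On the sphere \<open>V - \<psi>\<close> lies at least \<open>2 * \<eta>\<close>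
    below its value at \<open>p\<close>, so its maximiser \<open>q\<close> is not there.\<close>
  have "dist p q < d"
  proof (rule ccontr)
    assume "\<not> dist p q < d"
    with qp have "dist p q = d" by simp
    then have "\<kappa> * (dist p q)\<^sup>2 = 4 * \<eta>" by (simp add: \<eta>_def)
    moreover have "p \<in> cball p d" using d by simp
    note close[OF this]
    ultimately show False
      using max[OF qR qp(2)] q(2)[OF pD] close[OF qp(1)] \<eta> by linarith
  qed
  define r where "r = d - dist p q"
  have r: "0 < r" using \<open>dist p q < d\<close> by (simp add: r_def)
  \<comment> \<open>From \<open>q\<close> one may move both ways in space but only backwards in
    time, since \<open>q\<close> may have the same time as \<open>p\<close>.\<close>
  have inD: "q + w \<in> D" if "norm w < r" "snd w \<le> 0" for w
  proof -
    have "dist p (q + w) \<le> dist p q + norm w"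
      using dist_triangle[of p "q + w" q] by (simp add: dist_norm)
    with that qp show ?thesis by (simp add: D_def r_def)
  qed
  have "0 \<le> V1 (0, 1) q - \<psi>t q"
  proof (rule left_local_max_deriv_nonneg[OF _ r])
    show "((\<lambda>s. V (q + s *\<^sub>R (0, 1)) - \<psi> (q + s *\<^sub>R (0, 1))) has_real_derivative
        V1 (0, 1) q - \<psi>t q) (at 0)"
      using DERIV_diff[OF dV(1)[of q "(0, 1)" 0] \<psi>t[of q]]
      by (simp only: scaleR_zero_left add_0_right)
    fix s :: real assume s: "- r < s" "s \<le> 0"
    have "q + s *\<^sub>R (0, 1) \<in> D" by (rule inD) (use s in \<open>auto simp: norm_Pair\<close>)
    from q(2)[OF this]
    show "V (q + s *\<^sub>R (0, 1)) - \<psi> (q + s *\<^sub>R (0, 1)) \<le> V (q + 0 *\<^sub>R (0, 1)) - \<psi> (q + 0 *\<^sub>R (0, 1))"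
      by (simp only: scaleR_zero_left add_0_right)
  qed
  moreover have "V2 (i, 0) q - \<psi>xx i q \<le> 0" if i: "i \<in> Basis" for i
  proof (rule local_max_second_deriv_nonpos[OF _ _ r])
    show "((\<lambda>s. V (q + s *\<^sub>R (i, 0)) - \<psi> (q + s *\<^sub>R (i, 0))) has_real_derivative
        V1 (i, 0) (q + s *\<^sub>R (i, 0)) - \<psi>x i (q + s *\<^sub>R (i, 0))) (at s)" for s
      by (rule DERIV_diff[OF dV(1) \<psi>x[OF i]])
    show "((\<lambda>s. V1 (i, 0) (q + s *\<^sub>R (i, 0)) - \<psi>x i (q + s *\<^sub>R (i, 0))) has_real_derivative
        V2 (i, 0) q - \<psi>xx i q) (at 0)"
      using DERIV_diff[OF dV(2)[of "(i, 0)" q 0] \<psi>xx[OF i, of q]]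
      by (simp only: scaleR_zero_left add_0_right)
    fix s :: real assume s: "\<bar>s\<bar> < r"
    have "q + s *\<^sub>R (i, 0) \<in> D" by (rule inD) (use s i in \<open>auto simp: norm_Pair\<close>)
    from q(2)[OF this]
    show "V (q + s *\<^sub>R (i, 0)) - \<psi> (q + s *\<^sub>R (i, 0)) \<le> V (q + 0 *\<^sub>R (i, 0)) - \<psi> (q + 0 *\<^sub>R (i, 0))"
      by (simp only: scaleR_zero_left add_0_right)
  qed
  then have "(\<Sum>i\<in>Basis. V2 (i, 0) q) \<le> (\<Sum>i\<in>Basis. \<psi>xx i q)"
    by (intro sum_mono) auto
  \<comment> \<open>The derivative signs give
    \<open>V1 (0, 1) q - (\<Sum>i\<in>Basis. V2 (i, 0) q)\<close> at least the corresponding value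
    for \<open>\<psi>\<close>, which exceeds -1, whereas it equals -1.\<close>
  ultimately show False
    using heat[OF qp(1)] strict[OF qR] by linarith
qed

section \<open>Comparison with the barrier\<close>

lemma nondegeneracy_at_positive_point:
  fixes u :: "'a::euclidean_space \<times> real \<Rightarrow> real"
  assumes U: "open U" "continuous_on U u"
    and sol: "weak_heat_solution_on ({p. 0 < u p} \<inter> U) (\<lambda>p. - 1) u"
    and C: "cball x1 \<rho> \<times> {t1 - \<rho>\<^sup>2..t1} \<subseteq> U" and \<rho>: "0 < \<rho>" and pos: "0 < u (x1, t1)"
  shows "\<exists>p \<in> cball x1 \<rho> \<times> {t1 - \<rho>\<^sup>2..t1}. \<rho>\<^sup>2 / (4 * DIM('a) + 2) \<le> u p"
proof (rule ccontr)
  define n where "n = real DIM('a)"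
  \<comment> \<open>The barrier contributes \<open>- (2 * n + 1) * c = - 1/2\<close> to the heat
    operator, and the perturbation with \<open>\<kappa>\<close> at least -1/4 within unit time
    distance; the total stays above -1.\<close>
  define c where "c = 1 / (4 * n + 2)"
  define \<kappa> where "\<kappa> = 1 / (8 * (n + 1))"
  have n: "0 \<le> n" by (simp add: n_def)
  have c: "0 < c" "(2 * n + 1) * c = 1 / 2" using n by (auto simp: c_def field_simps)
  have \<kappa>: "0 < \<kappa>" "2 * \<kappa> * (n + 1) = 1 / 4" using n by (auto simp: \<kappa>_def field_simps)
  let ?C = "cball x1 \<rho> \<times> {t1 - \<rho>\<^sup>2..t1}"
  assume "\<not> (\<exists>p \<in> ?C. \<rho>\<^sup>2 / (4 * DIM('a) + 2) \<le> u p)"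
  then have small: "u p < c * \<rho>\<^sup>2" if "p \<in> ?C" for p
    using that by (auto simp: c_def n_def not_le add.commute)
  define \<beta> where "\<beta> p = c * ((norm (fst p - x1))\<^sup>2 - (snd p - t1))" for p :: "'a \<times> real"
  have cont\<beta>: "continuous_on S \<beta>" for S
    unfolding \<beta>_def by (intro continuous_intros)
  have p1C: "(x1, t1) \<in> ?C" using \<rho> by simp
  have "compact ?C" by (intro compact_Times compact_cball compact_Icc)
  moreover have "continuous_on ?C (\<lambda>p. u p - \<beta> p)"
    by (intro continuous_on_diff cont\<beta> continuous_on_subset[OF U(2) C])
  ultimately obtain p where p: "p \<in> ?C" "\<And>q. q \<in> ?C \<Longrightarrow> u q - \<beta> q \<le> u p - \<beta> p"
    using continuous_attains_sup[of ?C "\<lambda>p. u p - \<beta> p"] p1C by blast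
  obtain x t where xt: "p = (x, t)" by (cases p)
  have xt_bounds: "norm (x - x1) \<le> \<rho>" "t1 - \<rho>\<^sup>2 \<le> t" "t \<le> t1"
    using p(1) by (auto simp: xt dist_norm norm_minus_commute)
  have wp: "0 < u p - \<beta> p" using p(2)[OF p1C] pos by (simp add: \<beta>_def)
  \<comment> \<open>At \<open>p\<close> the barrier is below \<open>u p\<close>, hence below
    \<open>c * \<rho>\<^sup>2\<close>. Both summands of the barrier are nonnegative, so this single
    bound excludes the lateral side and the bottom.\<close>
  have \<beta>lt: "(norm (x - x1))\<^sup>2 - (t - t1) < \<rho>\<^sup>2"
    using wp small[OF p(1)] c(1) by (simp add: \<beta>_def xt) (metis less_trans mult_less_cancel_left_pos)
  have "0 \<le> (norm (x - x1))\<^sup>2 - (t - t1)"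
    using xt_bounds zero_le_power2[of "norm (x - x1)"] by linarith
  then have "0 \<le> \<beta> p" using c(1) by (simp add: \<beta>_def xt)
  with wp have up: "0 < u p" by simp
  have "(norm (x - x1))\<^sup>2 < \<rho>\<^sup>2" using \<beta>lt xt_bounds by linarith
  then have lat: "norm (x - x1) < \<rho>" using \<rho> by (simp add: power_less_imp_less_base)
  have bot: "t1 - \<rho>\<^sup>2 < t"
    using \<beta>lt zero_le_power2[of "norm (x - x1)"] by linarith
  let ?\<Omega> = "{p. 0 < u p} \<inter> U"
  have "?\<Omega> = U \<inter> u -` {0<..}" by auto
  then have "open ?\<Omega>" using continuous_open_preimage[OF U(2,1) open_greaterThan] by simp
  moreover have "p \<in> ?\<Omega>" using up p(1) C by blast
  ultimately obtain R0 where R0: "0 < R0" "ball p R0 \<subseteq> ?\<Omega>"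
    by (meson open_contains_ball)
  \<comment> \<open>The bounds on \<open>R\<close> keep the ball in the positivity set, keep time
    differences below 1 for strictness, and keep the past half-ball in the cylinder.\<close>
  define R where "R = min (min R0 1) (min (\<rho> - norm (x - x1)) (t - (t1 - \<rho>\<^sup>2)))"
  have R: "0 < R" "R \<le> R0" "R \<le> 1" "R \<le> \<rho> - norm (x - x1)" "R \<le> t - (t1 - \<rho>\<^sup>2)"
    using R0 lat bot by (auto simp: R_def)
  have near: "norm (fst q - x) < R" "\<bar>snd q - t\<bar> < R" if "q \<in> ball p R" for q
  proof -
    have "norm (fst q - x) \<le> dist p q" "\<bar>snd q - t\<bar> \<le> dist p q"
      using dist_fst_le[of q p] dist_snd_le[of q p]
      by (simp_all add: xt dist_norm dist_real_def norm_minus_commute)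
    with that show "norm (fst q - x) < R" "\<bar>snd q - t\<bar> < R" by auto
  qed
  \<comment> \<open>The added square turns the maximum of \<open>u - \<beta>\<close> at
    \<open>p\<close> into one with a quadratic gap.\<close>
  define \<psi> where "\<psi> q = \<beta> q + \<kappa> * (norm (q - p))\<^sup>2" for q
  define \<psi>t where "\<psi>t q = - c + 2 * \<kappa> * (snd q - t)" for q :: "'a \<times> real"
  define \<psi>x where "\<psi>x i q = 2 * c * ((fst q - x1) \<bullet> i) + 2 * \<kappa> * ((fst q - x) \<bullet> i)"
    for i and q :: "'a \<times> real"
  define \<psi>xx where "\<psi>xx i q = 2 * c + 2 * \<kappa>" for i :: 'a and q :: "'a \<times> real"
  have \<psi>_eq: "\<psi> q = c * ((fst q - x1) \<bullet> (fst q - x1) - (snd q - t1)) +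
      \<kappa> * ((fst q - x) \<bullet> (fst q - x) + (snd q - t) * (snd q - t))" for q
    by (simp add: \<psi>_def \<beta>_def power2_norm_eq_inner xt inner_prod_def)
  show False
  proof (rule weak_heat_solution_no_touching_above[where \<psi> = \<psi> and \<psi>t = \<psi>t and \<psi>x = \<psi>x and \<psi>xx = \<psi>xx,
        OF _ sol R(1) _ \<kappa>(1)])
    show "continuous_on ?\<Omega> u" using U(2) continuous_on_subset by blast
    show "ball p R \<subseteq> ?\<Omega>" using subset_ball[OF R(2), of p] R0(2) by (rule subset_trans)
    show "continuous_on UNIV \<psi>" unfolding \<psi>_def by (intro continuous_intros cont\<beta>)
    show "((\<lambda>s. \<psi> (q + s *\<^sub>R (0, 1))) has_real_derivative \<psi>t q) (at 0)" for q
      unfolding \<psi>_eq \<psi>t_def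
      by (auto intro!: derivative_eq_intros simp: algebra_simps)
    show "((\<lambda>s. \<psi> (q + s *\<^sub>R (i, 0))) has_real_derivative \<psi>x i (q + s *\<^sub>R (i, 0))) (at s)"
      for q i s
      unfolding \<psi>_eq \<psi>x_def has_field_derivative_def
      by (auto intro!: derivative_eq_intros simp: algebra_simps inner_commute)
    show "((\<lambda>s. \<psi>x i (q + s *\<^sub>R (i, 0))) has_real_derivative \<psi>xx i q) (at 0)"
      if "i \<in> Basis" for q i
      unfolding \<psi>x_def \<psi>xx_def has_field_derivative_def
      by (auto intro!: derivative_eq_intros simp: algebra_simps that)
    show "- 1 < \<psi>t q - (\<Sum>i\<in>Basis. \<psi>xx i q)" if "q \<in> ball p R" for q
    proof -
      have "- 1 \<le> snd q - t" using near(2)[OF that] R(3) by linarith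
      then have "2 * \<kappa> * (- 1) \<le> 2 * \<kappa> * (snd q - t)" using \<kappa>(1) by (intro mult_left_mono) auto
      moreover have "(\<Sum>i\<in>(Basis::'a set). \<psi>xx i q) = n * (2 * c + 2 * \<kappa>)"
        by (simp add: \<psi>xx_def n_def)
      ultimately show ?thesis using c(2) \<kappa>(2) by (simp add: \<psi>t_def algebra_simps)
    qed
    show "u q - \<psi> q \<le> u p - \<psi> p - \<kappa> * (dist p q)\<^sup>2" if "q \<in> ball p R" "snd q \<le> snd p" for q
    proof -
      have "norm (fst q - x1) \<le> norm (fst q - x) + norm (x - x1)"
        using norm_triangle_ineq[of "fst q - x" "x - x1"] by simp
      then have "norm (fst q - x1) \<le> \<rho>" using near(1)[OF that(1)] R(4) by linarith
      moreover have "t1 - \<rho>\<^sup>2 \<le> snd q" "snd q \<le> t1"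
        using near(2)[OF that(1)] R(5) that(2) xt_bounds by (auto simp: xt)
      ultimately have "q \<in> ?C" by (cases q) (auto simp: dist_norm norm_minus_commute)
      from p(2)[OF this] show ?thesis
        by (simp add: \<psi>_def dist_norm norm_minus_commute)
    qed
  qed
qed

section \<open>Passage to the closure of the positivity set\<close>

lemma open_par_cyl: "open (par_cyl r p)"
proof -
  obtain x t where "p = (x, t)" by (cases p)
  then have "par_cyl r p = ball x r \<times> {t - r\<^sup>2<..<t + r\<^sup>2}"
    by (auto simp: par_cyl_def dist_norm norm_minus_commute)
  then show ?thesis by (simp add: open_Times)
qed

theorem lemma3p3:
  shows "\<exists>c>0. \<forall>u :: (real ^ 'n) \<times> real \<Rightarrow> real.
           continuous_on (par_cyl 1 (0, 0)) u \<longrightarrow>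
           (\<forall>p \<in> par_cyl 1 (0, 0). 0 \<le> u p) \<longrightarrow>
           weak_heat_solution_on ({p. 0 < u p} \<inter> par_cyl 1 (0, 0)) (\<lambda>p. - 1) u \<longrightarrow>
           (\<forall>p0 \<in> closure ({p. 0 < u p} \<inter> par_cyl 1 (0, 0)) \<inter> par_cyl (1/2) (0, 0).
              \<forall>r \<in> {0<..<1/2}. (SUP p \<in> par_cyl_minus r p0. u p) \<ge> c * r\<^sup>2)"
proof (intro exI[of _ "1 / (4 * DIM(real ^ 'n) + 2)"] conjI allI impI ballI)
  fix u :: "(real ^ 'n) \<times> real \<Rightarrow> real" and p0 and r :: real
  let ?Q = "par_cyl 1 (0, 0) :: ((real ^ 'n) \<times> real) set"
  assume u: "continuous_on ?Q u"
    and sol: "weak_heat_solution_on ({p. 0 < u p} \<inter> ?Q) (\<lambda>p. - 1) u"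
    and p0: "p0 \<in> closure ({p. 0 < u p} \<inter> ?Q) \<inter> par_cyl (1/2) (0, 0)"
    and r: "r \<in> {0<..<1/2}"
  define c where "c = 1 / (4 * real DIM(real ^ 'n) + 2)"
  have c: "0 < c" by (simp add: c_def add_nonneg_pos)
  obtain x0 t0 where xt0: "p0 = (x0, t0)" by (cases p0)
  have x0: "norm x0 < 1/2" and t0: "\<bar>t0\<bar> < 1/4"
    using p0 by (auto simp: xt0 par_cyl_def power2_eq_square)
  have r2: "r\<^sup>2 < 1/4" using r power_strict_mono[of r "1/2" 2] by (simp add: power2_eq_square)
  define b where "b = min (1/2 - norm x0) (1/4 - \<bar>t0\<bar>)"
  have b: "0 < b" "b \<le> 1/2 - norm x0" "b \<le> 1/4 - \<bar>t0\<bar>" using x0 t0 by (auto simp: b_def)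
  \<comment> \<open>A compact subset of the unit cylinder, of spatial radius \<open>1/2 + r\<close>,
    containing the cylinders at \<open>p0\<close> and at all nearby points.\<close>
  define K where "K = cball (0::real ^ 'n) (1 - (1/2 - r)) \<times> {- (1/2)..1/2::real}"
  have "compact K" unfolding K_def by (intro compact_Times compact_cball compact_Icc)
  have KQ: "K \<subseteq> ?Q" using r by (auto simp: K_def par_cyl_def)
  have inK: "(x, t) \<in> K" if "norm (x - y) \<le> r" "norm (y - x0) \<le> b" "t \<le> s" "s - r\<^sup>2 - b / 2 \<le> t" "\<bar>s - t0\<bar> \<le> b / 2"
    for x y t s
  proof -
    have "norm x \<le> norm (x - y) + norm (y - x0) + norm x0"
      using norm_triangle_ineq[of "x - y" "y"] norm_triangle_ineq[of "y - x0" x0] by simp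
    then have "norm x \<le> 1 - (1/2 - r)" using that b by linarith
    moreover have "\<bar>t\<bar> \<le> 1/2" using that b r2 t0 by linarith
    ultimately show ?thesis by (auto simp: K_def)
  qed
  have cyl_K: "par_cyl_minus r p0 \<subseteq> K"
  proof
    fix q assume "q \<in> par_cyl_minus r p0"
    then obtain x t where "q = (x, t)" "norm (x - x0) < r" "\<bar>t - t0\<bar> < r\<^sup>2" "t < t0"
      by (auto simp: xt0 par_cyl_def par_cyl_minus_def)
    then show "q \<in> K" using b by (auto intro!: inK[of x x0 t t0])
  qed
  have uK: "continuous_on K u" using u KQ continuous_on_subset by blast
  then have "bdd_above (u ` K)"
    using \<open>compact K\<close> by (intro bounded_imp_bdd_above compact_imp_bounded compact_continuous_image)
  \<comment> \<open>A real supremum dominates the values only for sets bounded above.\<close>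
  then have bdd: "bdd_above (u ` par_cyl_minus r p0)"
    using cyl_K by (meson bdd_above_mono image_mono)
  define S where "S = (SUP p \<in> par_cyl_minus r p0. u p)"
  have upper: "u p \<le> S" if "p \<in> par_cyl_minus r p0" for p
    unfolding S_def by (rule cSUP_upper[OF that bdd])
  have "c * r\<^sup>2 \<le> S"
  proof (rule ccontr)
    assume "\<not> c * r\<^sup>2 \<le> S"
    then have "S / c < r\<^sup>2" using c by (simp add: field_simps)
    \<comment> \<open>A radius slightly below \<open>r\<close> keeps the strict inequality and
      leaves room for shifting its closed cylinder into the open one at \<open>p0\<close>.\<close>
    then have "eventually (\<lambda>\<rho>. S / c < \<rho>\<^sup>2) (at_left r)"
      by (intro order_tendstoD(1)[of _ "r\<^sup>2"] tendsto_intros)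
    moreover have "eventually (\<lambda>\<rho>. 0 < \<rho> \<and> \<rho> < r) (at_left r)"
      using r eventually_at_left_real[of 0 r] by simp
    ultimately have "\<exists>\<rho>. S / c < \<rho>\<^sup>2 \<and> 0 < \<rho> \<and> \<rho> < r"
      using eventually_happens'[OF trivial_limit_at_left_real] eventually_conj by blast
    then obtain \<rho> where \<rho>: "0 < \<rho>" "\<rho> < r" and S\<rho>: "S < c * \<rho>\<^sup>2"
      using c by (auto simp: field_simps)
    have \<rho>2: "\<rho>\<^sup>2 < r\<^sup>2" using \<rho> by (simp add: power_strict_mono)
    obtain \<delta> where \<delta>: "0 < \<delta>"
      "\<And>p q. p \<in> K \<Longrightarrow> q \<in> K \<Longrightarrow> dist q p < \<delta> \<Longrightarrow> dist (u q) (u p) < c * \<rho>\<^sup>2 - S"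
      using compact_uniformly_continuous[OF uK \<open>compact K\<close>] S\<rho>
      unfolding uniformly_continuous_on_def by (metis diff_gt_0_iff_gt)
    \<comment> \<open>The final shift moves a point by less than \<open>2 * \<tau>\<close>, hence
      less than \<open>\<delta>\<close>: once from \<open>p1\<close> to \<open>p0\<close> and once
      by \<open>\<tau>\<close> back in time, which makes the time strictly earlier than
      \<open>t0\<close>. The other bounds keep the cylinder of \<open>p1\<close> in \<open>K\<close>
      and the shifted time within \<open>r\<^sup>2\<close> of \<open>t0\<close>.\<close>
    define \<tau> where "\<tau> = min (min (\<delta> / 2) (b / 2)) (r\<^sup>2 - \<rho>\<^sup>2) / 2"
    have \<tau>: "0 < \<tau>" "\<tau> < \<delta> / 2" "\<tau> < b / 2" "\<tau> < r\<^sup>2 - \<rho>\<^sup>2"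
      using \<delta> b \<rho>2 by (auto simp: \<tau>_def min_def)
    obtain p1 where p1: "0 < u p1" "p1 \<in> ?Q" "dist p1 p0 < \<tau>"
      using p0 \<tau>(1) by (auto simp: closure_approachable)
    obtain x1 t1 where xt1: "p1 = (x1, t1)" by (cases p1)
    have x1: "norm (x1 - x0) < \<tau>" and t1: "\<bar>t1 - t0\<bar> < \<tau>"
      using p1(3) dist_fst_le[of p1 p0] dist_snd_le[of p1 p0]
      by (simp_all add: xt0 xt1 dist_norm dist_real_def)
    let ?C = "cball x1 \<rho> \<times> {t1 - \<rho>\<^sup>2..t1}"
    have CK: "?C \<subseteq> K"
    proof
      fix q assume "q \<in> ?C"
      then obtain x t where "q = (x, t)" "norm (x - x1) \<le> \<rho>" "t1 - \<rho>\<^sup>2 \<le> t" "t \<le> t1"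
        by (auto simp: dist_norm norm_minus_commute)
      then show "q \<in> K" using \<rho> \<rho>2 x1 t1 \<tau> b by (auto intro!: inK[of x x1 t t1])
    qed
    have "\<exists>p \<in> ?C. \<rho>\<^sup>2 / (4 * DIM(real ^ 'n) + 2) \<le> u p"
      by (rule nondegeneracy_at_positive_point[OF open_par_cyl u sol])
        (use CK KQ \<rho> p1 in \<open>auto simp: xt1\<close>)
    then obtain x t where q: "(x, t) \<in> ?C" "c * \<rho>\<^sup>2 \<le> u (x, t)"
      by (auto simp: c_def add.commute)
    txt \<open>The positive point \<open>p1\<close> may lie later than \<open>t0\<close>, so the point found in its cylinder is
      translated back into the cylinder of \<open>p0\<close>.\<close>
    define q' where "q' = (x + (x0 - x1), t + (t0 - t1) - \<tau>)"
    have "norm (x - x1) \<le> \<rho>" "t1 - \<rho>\<^sup>2 \<le> t" "t \<le> t1"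
      using q(1) by (auto simp: dist_norm norm_minus_commute)
    then have q': "q' \<in> par_cyl_minus r p0"
      using \<rho> \<tau> by (auto simp: q'_def xt0 par_cyl_minus_def par_cyl_def algebra_simps)
    have "q' - (x, t) = (p0 - p1) - (0, \<tau>)"
      by (simp add: q'_def xt0 xt1)
    then have "dist q' (x, t) \<le> dist p1 p0 + \<tau>"
      using norm_triangle_ineq4[of "p0 - p1" "(0, \<tau>)"] \<tau>(1)
      by (simp add: dist_norm norm_minus_commute norm_Pair)
    then have "dist (u q') (u (x, t)) < c * \<rho>\<^sup>2 - S"
      using \<delta>(2)[of "(x, t)" q'] q(1) CK q' cyl_K p1(3) \<tau>(2) by fastforce
    then have "S < u q'" using q(2) by (simp add: dist_real_def abs_less_iff)
    with upper[OF q'] show False by simp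
  qed
  then show "1 / (4 * DIM(real ^ 'n) + 2) * r\<^sup>2 \<le> (SUP p \<in> par_cyl_minus r p0. u p)"
    by (simp add: c_def S_def add.commute)
qed (simp add: add_nonneg_pos)

end
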